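(* Let $\mathcal G(\pi,V)$ be a synchronous game with question set $S$ and answer set $A$, and let $\mathcal K\in\{\mathcal{CP},\mathcal{CS}_+\}$. The following are equivalent: (i) $\mathcal G$ admits a perfect $\mathcal K$-strategy. (ii) There exists $X\in\mathcal K^{|S\times A|}$ satisfying: $\langle J_{s,s'},X\rangle=1$ for all $s,s'\in S$; $X[(s,a),(s,a')]=0$ for all $s\in S$, $a\neq a'\in A$; and $X[(s,a),(s',a')]=0$ for all $a,a',s,s'$ with $\pi(s,s')>0$ and $V(a,a'|s,s')=0$. (iii) There exists $\tilde X\in\mathcal K^{1+|S\times A|}$ satisfying: $\langle J_{s,s},\tilde X\rangle=\langle J_{0,s},\tilde X\rangle=1$ for all $s\in\{0\}\cup S$; $\tilde X[(s,a),(s,a')]=0$ for all $s\in S$, $a\ne a'\in A$; and $\tilde X[(s,a),(s',a')]=0$ for all $a,a',s,s'$ with $\pi(s,s')>0$ and $V(a,a'|s,s')=0$.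
   Context: A nonlocal game $\mathcal G(\pi,V)$ consists of finite nonempty question sets $S,T$, answer sets $A,B$, a probability distribution $\pi$ on $S\times T$ and a predicate $V:A\times B\times S\times T\to\{0,1\}$, written $V(a,b|s,t)$. It is synchronous if $S=T$, $A=B$, $V(a,a'|s,s)=0$ for all $s\in S$, $a\ne a'\in A$, and $\pi(s,s)>0$ for all $s\in S$. Cones. $\mathcal{CP}^n$: $n\times n$ Gram matrices $(\langle x_i,x_j\rangle)$ of vectors $x_i\in\mathbb R^d_+$ (some $d\ge1$). $\mathcal{CS}_+^n$: matrices $(\mathrm{Tr}(X_iX_j))_{i,j=1}^n$ with $X_i$ real symmetric psd $d\times d$ matrices (some $d\ge1$). Perfect strategies. For a game with sets $S,T,A,B$ let $N=|S||A|+|T||B|$; real symmetric $N\times N$ matrices are indexed by the disjoint union of $S\times A$ and $T\times B$ (when $S=T$, two disjoint copies are used). $\mathrm{Corr}(\mathcal K)$ is the set of vectors $p=(p(a,b|s,t))$ for which there is $X\in\mathcal K^N$ such that each block of $X$ indexed by a pair $i,j$ in the disjoint union of $S$ and $T$ has entries summing to $1$, and $X[(s,a),(t,b)]=p(a,b|s,t)$ for all $(s,a)\in S\times A$, $(t,b)\in T\times B$. $\mathcal G$ admits a perfect $\mathcal K$-strategy if the supremum of $\sum_{s,t}\pi(s,t)\sum_{a,b}V(a,b|s,t)p(a,b|s,t)$ over $p\in\mathrm{Corr}(\mathcal K)$ equals $1$ and is achieved by some $p\in\mathrm{Corr}(\mathcal K)$. Block sums in (ii), (iii). Matrices of size $|S\times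 A|$ are indexed by $S\times A$; those of size $1+|S\times A|$ have an additional index $0$. For $s,s'\in S$, $\langle J_{s,s'},X\rangle:=\sum_{a,a'\in A}X[(s,a),(s',a')]$; $\langle J_{0,s},X\rangle:=\sum_{a\in A}X[0,(s,a)]$; $\langle J_{0,0},X\rangle:=X[0,0]$. *)

theory Defs
  imports
    "HOL-Analysis.Analysis"
    "HOL-Probability.Probability_Mass_Function"
    "Jordan_Normal_Form.Matrix"
begin

text \<open>
  Matrices indexed by a finite set (questions and answers) have type \<open>real^'i^'i\<close>. The vectors and
  matrices in a Gram representation, whose dimension d is existentially quantified, are those of
  theory \<open>Matrix\<close>. The infix \<open>$\<close> is reserved for the former.
\<close>

no_notation Matrix.vec_index (infixl \<open>$\<close> 100)

text \<open>
  Question and answer sets are finite types, hence nonempty; they are otherwise arbitrary.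
  The distribution on pairs of questions is a probability mass function, and the predicate
  \<open>V a b s t\<close> stands for V(a,b|s,t) = 1.
\<close>

type_synonym ('a, 'b, 's, 't) predicate = "'a \<Rightarrow> 'b \<Rightarrow> 's \<Rightarrow> 't \<Rightarrow> bool"

definition synchronous_game ::
    "('s::finite \<times> 's) pmf \<Rightarrow> ('a::finite, 'a, 's, 's) predicate \<Rightarrow> bool" where
  "synchronous_game \<pi> V \<longleftrightarrow>
     (\<forall>s a a'. a \<noteq> a' \<longrightarrow> \<not> V a a' s s) \<and> (\<forall>s. pmf \<pi> (s, s) > 0)"

definition mat_trace :: "real mat \<Rightarrow> real" where
  "mat_trace M = (\<Sum>k<dim_row M. M $$ (k, k))"

definition psd_mat :: "nat \<Rightarrow> real mat \<Rightarrow> bool" where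
  "psd_mat d M \<longleftrightarrow> M \<in> carrier_mat d d \<and> transpose_mat M = M \<and>
     (\<forall>v \<in> carrier_vec d. scalar_prod v (M *\<^sub>v v) \<ge> 0)"

definition nonneg_vec :: "nat \<Rightarrow> real Matrix.vec \<Rightarrow> bool" where
  "nonneg_vec d v \<longleftrightarrow> v \<in> carrier_vec d \<and> (\<forall>k<d. vec_index v k \<ge> 0)"

definition completely_positive :: "(real^'i^'i::finite) set" where
  "completely_positive =
     {X. \<exists>d\<ge>1. \<exists>x :: 'i \<Rightarrow> real Matrix.vec.
        (\<forall>i. nonneg_vec d (x i)) \<and> (\<forall>i j. X $ i $ j = scalar_prod (x i) (x j))}"

definition completely_psd :: "(real^'i^'i::finite) set" where
  "completely_psd =
     {X. \<exists>d\<ge>1. \<exists>M :: 'i \<Rightarrow> real mat.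
        (\<forall>i. psd_mat d (M i)) \<and> (\<forall>i j. X $ i $ j = mat_trace (M i * M j))}"

text \<open>
  The cone is passed around by name, because one and the same cone is used at several index
  types, and HOL has no quantification over polymorphic values.
\<close>

datatype cone_name = CP | CSplus

fun matrix_cone :: "cone_name \<Rightarrow> (real^'i^'i::finite) set" where
  "matrix_cone CP = completely_positive"
| "matrix_cone CSplus = completely_psd"

definition block_sum :: "'i::finite set \<Rightarrow> 'i set \<Rightarrow> real^'i^'i \<Rightarrow> real" where
  "block_sum I J X = (\<Sum>i\<in>I. \<Sum>j\<in>J. X $ i $ j)"

fun sum_block :: "'s + 't \<Rightarrow> (('s \<times> 'a) + ('t \<times> 'b)) set" where
  "sum_block (Inl s) = range (\<lambda>a. Inl (s, a))"
| "sum_block (Inr t) = range (\<lambda>b. Inr (t, b))"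

definition block :: "'s \<Rightarrow> ('s \<times> 'a) set" where
  "block s = range (\<lambda>a. (s, a))"

text \<open>\<open>None\<close> plays the role of the additional index 0.\<close>

fun block0 :: "'s option \<Rightarrow> ('s \<times> 'a) option set" where
  "block0 None = {None}"
| "block0 (Some s) = range (\<lambda>a. Some (s, a))"

definition Corr ::
    "cone_name \<Rightarrow> ('a::finite \<Rightarrow> 'b::finite \<Rightarrow> 's::finite \<Rightarrow> 't::finite \<Rightarrow> real) set" where
  "Corr K =
     {p. \<exists>X \<in> matrix_cone K.
        (\<forall>i j. block_sum (sum_block i) (sum_block j) X = 1) \<and>
        (\<forall>s a t b. X $ Inl (s, a) $ Inr (t, b) = p a b s t)}"

definition winning_prob ::
    "('s::finite \<times> 't::finite) pmf \<Rightarrow> ('a::finite, 'b::finite, 's, 't) predicate \<Rightarrow>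
     ('a \<Rightarrow> 'b \<Rightarrow> 's \<Rightarrow> 't \<Rightarrow> real) \<Rightarrow> real" where
  "winning_prob \<pi> V p =
     (\<Sum>s\<in>UNIV. \<Sum>t\<in>UNIV. pmf \<pi> (s, t) *
        (\<Sum>a\<in>UNIV. \<Sum>b\<in>UNIV. of_bool (V a b s t) * p a b s t))"

text \<open>
  The supremum is taken in the extended reals, where it always is the least upper bound.
\<close>

definition perfect_strategy ::
    "cone_name \<Rightarrow> ('s::finite \<times> 't::finite) pmf \<Rightarrow> ('a::finite, 'b::finite, 's, 't) predicate \<Rightarrow>
     bool" where
  "perfect_strategy K \<pi> V \<longleftrightarrow>
     (SUP p \<in> Corr K. ereal (winning_prob \<pi> V p)) = 1 \<and>
     (\<exists>p \<in> Corr K. winning_prob \<pi> V p = 1)"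

end

theory Submission
  imports Defs
begin

text \<open>All block sums being 1 forces the Gram factors of each question to add up to one and the same
  unit element, because two elements of norm 1 with inner product 1 are equal. A perfect strategy
  therefore gives, for every question, two decompositions of that element which are mutually
  orthogonal by synchronicity, and such decompositions coincide. Hence Alice's and Bob's factors
  agree and one of the two copies can be dropped. The factor at the index 0 is the common sum.\<close>

text \<open>Orthogonality is available only as a vanishing trace inner product, while comparing two
  decompositions calls for vanishing matrix products. Positivity bridges the gap: for positive
  semidefinite \<open>A\<close> and \<open>B\<close>, Tr(AB) = 0 forces AB = 0. The common sum need
  not be the identity, nor invertible, and the factors need not be projections, so the comparison
  works with products and traces alone. The weights \<pi>(s,s) > 0 are what turns the rule for equal
  questions into such orthogonality: a perfect strategy is constrained only at question pairs of
  positive weight. The dimension \<open>d\<close> is existentially quantified, so matrices are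
  modelled as functions on pairs of naturals that are read only below \<open>d\<close>; equalities
  between them are claimed only there.\<close>

definition bilin :: "nat \<Rightarrow> (nat \<Rightarrow> nat \<Rightarrow> real) \<Rightarrow> (nat \<Rightarrow> real) \<Rightarrow> (nat \<Rightarrow> real) \<Rightarrow> real" where
  "bilin d A v w = (\<Sum>i<d. \<Sum>j<d. v i * A i j * w j)"

definition psd_fun :: "nat \<Rightarrow> (nat \<Rightarrow> nat \<Rightarrow> real) \<Rightarrow> bool" where
  "psd_fun d A \<longleftrightarrow> (\<forall>i<d. \<forall>j<d. A i j = A j i) \<and> (\<forall>v. bilin d A v v \<ge> 0)"

definition frob :: "nat \<Rightarrow> (nat \<Rightarrow> nat \<Rightarrow> real) \<Rightarrow> (nat \<Rightarrow> nat \<Rightarrow> real) \<Rightarrow> real" where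
  "frob d A B = (\<Sum>i<d. \<Sum>j<d. A i j * B i j)"

definition mprod :: "nat \<Rightarrow> (nat \<Rightarrow> nat \<Rightarrow> real) \<Rightarrow> (nat \<Rightarrow> nat \<Rightarrow> real) \<Rightarrow> nat \<Rightarrow> nat \<Rightarrow> real" where
  "mprod d A B i j = (\<Sum>k<d. A i k * B k j)"

definition unitv :: "nat \<Rightarrow> nat \<Rightarrow> real" where
  "unitv i k = of_bool (k = i)"

section \<open>Positive semidefinite forms and Cauchy-Schwarz\<close>

lemma psd_fun_sym: "psd_fun d A \<Longrightarrow> i < d \<Longrightarrow> j < d \<Longrightarrow> A i j = A j i"
  by (simp add: psd_fun_def)

lemma psd_fun_nonneg: "psd_fun d A \<Longrightarrow> bilin d A v v \<ge> 0"
  by (simp add: psd_fun_def)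

lemma bilin_sym:
  assumes "psd_fun d A"
  shows "bilin d A v w = bilin d A w v"
  unfolding bilin_def
  by (subst sum.swap, intro sum.cong refl) (simp add: psd_fun_sym[OF assms] mult_ac)

lemma bilin_cong:
  assumes "\<And>i. i < d \<Longrightarrow> v i = v' i" "\<And>i. i < d \<Longrightarrow> w i = w' i"
  shows "bilin d A v w = bilin d A v' w'"
  unfolding bilin_def using assms by (intro sum.cong refl) simp

lemma bilin_unitv_left: "i < d \<Longrightarrow> bilin d A (unitv i) w = (\<Sum>j<d. A i j * w j)"
  unfolding bilin_def unitv_def
  by (subst sum.swap)
    (simp add: mult.assoc of_bool_def if_distrib[of "\<lambda>x. x * _"] cong: if_cong)

lemma bilin_unitv: "i < d \<Longrightarrow> j < d \<Longrightarrow> bilin d A (unitv i) (unitv j) = A i j"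
  by (simp add: bilin_unitv_left) (simp add: unitv_def of_bool_def if_distrib[of "\<lambda>x. _ * x"] cong: if_cong)

lemma bilin_line:
  assumes "psd_fun d A"
  shows "bilin d A (\<lambda>k. v k + t * w k) (\<lambda>k. v k + t * w k) =
    bilin d A v v + 2 * t * bilin d A v w + t\<^sup>2 * bilin d A w w"
proof -
  have "bilin d A (\<lambda>k. v k + t * w k) (\<lambda>k. v k + t * w k) =
    bilin d A v v + t * bilin d A v w + t * bilin d A w v + t\<^sup>2 * bilin d A w w"
    unfolding bilin_def by (simp add: algebra_simps sum.distrib sum_distrib_left power2_eq_square)
  then show ?thesis using bilin_sym[OF assms, of v w] by simp
qed

text \<open>The form is nonnegative along the line v + t w, a polynomial of degree at most 2 in t.
  The form is only semidefinite, so the leading coefficient may vanish and is treated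
  separately.\<close>

lemma bilin_Cauchy_Schwarz:
  assumes "psd_fun d A"
  shows "(bilin d A v w)\<^sup>2 \<le> bilin d A v v * bilin d A w w"
proof -
  define b where "b = bilin d A v w"
  define q where "q = bilin d A v v"
  define r where "r = bilin d A w w"
  have line: "0 \<le> q + 2 * t * b + t\<^sup>2 * r" for t
    using psd_fun_nonneg[OF assms, of "\<lambda>k. v k + t * w k"]
    unfolding bilin_line[OF assms] b_def q_def r_def .
  have "r \<ge> 0" unfolding r_def by (rule psd_fun_nonneg[OF assms])
  have "b\<^sup>2 \<le> q * r"
  proof (cases "r = 0")
    case True
    have "b = 0"
    proof (rule ccontr)
      assume "b \<noteq> 0"
      \<comment> \<open>At this t the remaining linear polynomial q + 2 t b takes the value
        -1.\<close>
      then show False using line[of "- (q + 1) / (2 * b)"] True by (simp add: field_simps)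
    qed
    then show ?thesis using True by simp
  next
    case False
    with \<open>r \<ge> 0\<close> have "r > 0" by simp
    \<comment> \<open>The minimiser of the quadratic.\<close>
    then show ?thesis using line[of "- b / r"] by (simp add: field_simps power2_eq_square)
  qed
  then show ?thesis by (simp add: b_def q_def r_def)
qed

text \<open>Cauchy-Schwarz against each unit vector: a vector on which a semidefinite form vanishes
  lies in the kernel of the matrix.\<close>

lemma bilin_isotropic:
  assumes "psd_fun d A" "bilin d A w w = 0" "i < d"
  shows "(\<Sum>j<d. A i j * w j) = 0"
  using bilin_Cauchy_Schwarz[OF assms(1), of "unitv i" w] assms(2,3)
  by (simp add: bilin_unitv_left)

lemma psd_fun_zero_diag:
  assumes "psd_fun d A" "i < d" "j < d" "A i i = 0"
  shows "A i j = 0"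
  using bilin_Cauchy_Schwarz[OF assms(1), of "unitv i" "unitv j"] assms
  by (simp add: bilin_unitv)

text \<open>Gaussian elimination: subtracting the rank one matrix given by row \<open>i\<close> clears that row and,
  by Cauchy--Schwarz, preserves positivity. This avoids the spectral theorem.\<close>

lemma psd_fun_rank_one_sum:
  assumes "psd_fun d A"
  shows "\<exists>(n::nat) u. \<forall>i<d. \<forall>j<d. A i j = (\<Sum>k<n. u k i * u k j)"
  using assms
\<comment> \<open>Counting nonzero diagonal entries lets each elimination keep the dimension
  \<open>d\<close> fixed.\<close>
proof (induction "card {i. i < d \<and> A i i \<noteq> 0}" arbitrary: A rule: less_induct)
  case less
  show ?case
  proof (cases "\<exists>i<d. A i i \<noteq> 0")
    case False
    then have "\<forall>i<d. \<forall>j<d. A i j = 0"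
      using psd_fun_zero_diag[OF less.prems] by blast
    then show ?thesis by (intro exI[of _ 0]) simp
  next
    case True
    then obtain p where p: "p < d" "A p p \<noteq> 0" by blast
    have "A p p \<ge> 0"
      using psd_fun_nonneg[OF less.prems, of "unitv p"] p by (simp add: bilin_unitv)
    with p have pos: "A p p > 0" by simp
    define B where "B i j = A i j - A p i * A p j / A p p" for i j
    have quad: "bilin d B v v = bilin d A v v - (bilin d A (unitv p) v)\<^sup>2 / A p p" for v
    proof -
      have "bilin d B v v = bilin d A v v - (\<Sum>i<d. \<Sum>j<d. (A p i * v i) * (A p j * v j) / A p p)"
        unfolding bilin_def B_def by (simp add: algebra_simps sum_subtractf)
      also have "(\<Sum>i<d. \<Sum>j<d. (A p i * v i) * (A p j * v j) / A p p) =
          (bilin d A (unitv p) v)\<^sup>2 / A p p"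
        using p by (simp add: bilin_unitv_left power2_eq_square sum_product sum_divide_distrib)
      finally show ?thesis .
    qed
    have "psd_fun d B"
      unfolding psd_fun_def
    proof (intro conjI allI impI)
      fix i j assume "i < d" "j < d"
      then show "B i j = B j i" using psd_fun_sym[OF less.prems] by (simp add: B_def)
    next
      fix v
      have "(bilin d A (unitv p) v)\<^sup>2 \<le> A p p * bilin d A v v"
        using bilin_Cauchy_Schwarz[OF less.prems, of "unitv p" v] p by (simp add: bilin_unitv)
      then show "bilin d B v v \<ge> 0" using pos by (simp add: quad field_simps)
    qed
    have "{i. i < d \<and> B i i \<noteq> 0} \<subset> {i. i < d \<and> A i i \<noteq> 0}"
    proof (rule psubsetI)
      \<comment> \<open>A zero diagonal entry forces its whole row to vanish, so elimination creates
        no new nonzero diagonal entry, while the pivot itself disappears.\<close>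
      have "B i i = 0" if "i < d" "A i i = 0" for i
      proof -
        have "A p i = 0"
          using psd_fun_zero_diag[OF less.prems that(1) p(1) that(2)]
            psd_fun_sym[OF less.prems that(1) p(1)] by argo
        then show ?thesis using that by (simp add: B_def)
      qed
      then show "{i. i < d \<and> B i i \<noteq> 0} \<subseteq> {i. i < d \<and> A i i \<noteq> 0}" by blast
      have "B p p = 0" using p by (simp add: B_def)
      then show "{i. i < d \<and> B i i \<noteq> 0} \<noteq> {i. i < d \<and> A i i \<noteq> 0}" using p by blast
    qed
    then have "card {i. i < d \<and> B i i \<noteq> 0} < card {i. i < d \<and> A i i \<noteq> 0}"
      by (intro psubset_card_mono) auto
    from less.hyps[OF this \<open>psd_fun d B\<close>] obtain n :: nat and u
      where u: "\<forall>i<d. \<forall>j<d. B i j = (\<Sum>k<n. u k i * u k j)" by blast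
    define u' where "u' = u(n := \<lambda>i. A p i / sqrt (A p p))"
    have "A i j = (\<Sum>k<Suc n. u' k i * u' k j)" if "i < d" "j < d" for i j
    proof -
      have "A i j = B i j + A p i * A p j / A p p" by (simp add: B_def)
      also have "B i j = (\<Sum>k<n. u' k i * u' k j)" using u that by (simp add: u'_def)
      also have "A p i * A p j / A p p = u' n i * u' n j"
        using pos by (simp add: u'_def)
      finally show ?thesis by simp
    qed
    then show ?thesis by (intro exI[of _ "Suc n"] exI[of _ u']) simp
  qed
qed

text \<open>With A a sum of u u^T, the inner product of A and B is the sum of the values u^T B u,
  each nonnegative. If it is 0, each u is isotropic for B, so B u = 0 and hence AB = 0.\<close>

lemma frob_psd:
  assumes "psd_fun d A" "psd_fun d B"
  shows frob_psd_nonneg: "frob d A B \<ge> 0"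
    and frob_psd_eq_0: "\<And>i j. frob d A B = 0 \<Longrightarrow> i < d \<Longrightarrow> j < d \<Longrightarrow> mprod d A B i j = 0"
proof -
  obtain n :: nat and u where u: "\<forall>i<d. \<forall>j<d. A i j = (\<Sum>k<n. u k i * u k j)"
    using psd_fun_rank_one_sum[OF assms(1)] by blast
  have "frob d A B = (\<Sum>i<d. \<Sum>j<d. \<Sum>k<n. u k i * B i j * u k j)"
    unfolding frob_def using u by (intro sum.cong refl) (simp add: sum_distrib_left sum_distrib_right mult_ac)
  also have "\<dots> = (\<Sum>i<d. \<Sum>k<n. \<Sum>j<d. u k i * B i j * u k j)"
    by (intro sum.cong refl sum.swap)
  also have "\<dots> = (\<Sum>k<n. bilin d B (u k) (u k))"
    unfolding bilin_def by (rule sum.swap)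
  finally have eq: "frob d A B = (\<Sum>k<n. bilin d B (u k) (u k))" .
  show "frob d A B \<ge> 0"
    unfolding eq by (intro sum_nonneg psd_fun_nonneg assms)
  fix i j assume 0: "frob d A B = 0" and ij: "i < d" "j < d"
  have iso: "bilin d B (u k) (u k) = 0" if "k < n" for k
    using 0 that unfolding eq by (simp add: sum_nonneg_eq_0_iff psd_fun_nonneg assms)
  have "mprod d A B i j = (\<Sum>l<d. \<Sum>k<n. u k i * (B j l * u k l))"
    unfolding mprod_def using u ij psd_fun_sym[OF assms(2)]
    by (intro sum.cong refl) (simp add: sum_distrib_left sum_distrib_right mult_ac)
  also have "\<dots> = (\<Sum>k<n. u k i * (\<Sum>l<d. B j l * u k l))"
    by (subst sum.swap) (simp add: sum_distrib_left)
  also have "\<dots> = 0"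
    using bilin_isotropic[OF assms(2) iso] ij by simp
  finally show "mprod d A B i j = 0" .
qed

section \<open>Sums and products; comparing orthogonal decompositions\<close>

lemma bilin_sum: "bilin d (\<lambda>i j. \<Sum>a\<in>I. M a i j) v w = (\<Sum>a\<in>I. bilin d (M a) v w)"
proof -
  have "bilin d (\<lambda>i j. \<Sum>a\<in>I. M a i j) v w = (\<Sum>i<d. \<Sum>j<d. \<Sum>a\<in>I. v i * M a i j * w j)"
    unfolding bilin_def by (simp add: sum_distrib_left sum_distrib_right)
  also have "\<dots> = (\<Sum>i<d. \<Sum>a\<in>I. \<Sum>j<d. v i * M a i j * w j)"
    by (intro sum.cong refl sum.swap)
  also have "\<dots> = (\<Sum>a\<in>I. bilin d (M a) v w)"
    unfolding bilin_def by (rule sum.swap)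
  finally show ?thesis .
qed

lemma psd_fun_sum:
  assumes "\<And>a. a \<in> I \<Longrightarrow> psd_fun d (M a)"
  shows "psd_fun d (\<lambda>i j. \<Sum>a\<in>I. M a i j)"
  unfolding psd_fun_def bilin_sum
proof (intro conjI allI impI)
  show "(\<Sum>a\<in>I. M a i j) = (\<Sum>a\<in>I. M a j i)" if "i < d" "j < d" for i j
    using psd_fun_sym[OF assms] that by (intro sum.cong refl) auto
  show "0 \<le> (\<Sum>a\<in>I. bilin d (M a) v v)" for v
    by (intro sum_nonneg psd_fun_nonneg assms)
qed

lemma mprod_sum_right: "mprod d A (\<lambda>i j. \<Sum>a\<in>I. M a i j) i j = (\<Sum>a\<in>I. mprod d A (M a) i j)"
  unfolding mprod_def sum_distrib_left by (rule sum.swap)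

lemma mprod_sum_left: "mprod d (\<lambda>i j. \<Sum>a\<in>I. M a i j) B i j = (\<Sum>a\<in>I. mprod d (M a) B i j)"
  unfolding mprod_def sum_distrib_right by (rule sum.swap)

lemma mprod_transpose:
  assumes "psd_fun d A" "psd_fun d B" "i < d" "j < d"
  shows "mprod d A B i j = mprod d B A j i"
  unfolding mprod_def using assms psd_fun_sym by (intro sum.cong refl) (simp add: mult.commute)

lemma mprod_cong:
  assumes "\<And>i j. i < d \<Longrightarrow> j < d \<Longrightarrow> A i j = A' i j"
    and "\<And>i j. i < d \<Longrightarrow> j < d \<Longrightarrow> B i j = B' i j" and "i < d" "j < d"
  shows "mprod d A B i j = mprod d A' B' i j"
  unfolding mprod_def using assms by simp

text \<open>With \<open>E\<close> the common sum and \<open>D = x a - y a\<close>, orthogonality gives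
  \<open>x a E = x a y a = E y a\<close>, hence \<open>E D = - D E\<close> and \<open>Tr (D E D) = 0\<close>. As every \<open>x b\<close> and
  \<open>y b\<close> is dominated by \<open>E\<close>, it annihilates \<open>D\<close>, so \<open>D\<^sup>2 = 0\<close>.\<close>

lemma orthogonal_decompositions_eq:
  fixes x y :: "'a::finite \<Rightarrow> nat \<Rightarrow> nat \<Rightarrow> real"
  assumes x: "\<And>a. psd_fun d (x a)" and y: "\<And>a. psd_fun d (y a)"
    and sums: "\<And>i j. i < d \<Longrightarrow> j < d \<Longrightarrow> (\<Sum>a\<in>UNIV. x a i j) = (\<Sum>a\<in>UNIV. y a i j)"
    and orth: "\<And>a b. a \<noteq> b \<Longrightarrow> frob d (x a) (y b) = 0"
    and ij: "i < d" "j < d"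
  shows "x a i j = y a i j"
proof -
  define E where "E i j = (\<Sum>a\<in>UNIV. x a i j)" for i j
  define D where "D i j = x a i j - y a i j" for i j
  have E_y: "E i j = (\<Sum>a\<in>UNIV. y a i j)" if "i < d" "j < d" for i j
    using sums that by (simp add: E_def)
  have psd_E: "psd_fun d E" using psd_fun_sum[of UNIV d x] x by (simp add: E_def[abs_def])
  have zero: "mprod d (x a) (y b) i j = 0" if "a \<noteq> b" "i < d" "j < d" for a b i j
    using frob_psd_eq_0[OF x y orth] that by blast
  have D_sym: "D i j = D j i" if "i < d" "j < d" for i j
    using psd_fun_sym[OF x] psd_fun_sym[OF y] that by (simp add: D_def)
  have xE: "mprod d (x a) E i j = mprod d (x a) (y a) i j" if "i < d" "j < d" for i j
  proof -
    have "mprod d (x a) E i j = mprod d (x a) (\<lambda>i j. \<Sum>b\<in>UNIV. y b i j) i j"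
      by (rule mprod_cong) (use E_y that in auto)
    also have "\<dots> = (\<Sum>b\<in>UNIV. mprod d (x a) (y b) i j)" by (rule mprod_sum_right)
    also have "\<dots> = (\<Sum>b\<in>{a}. mprod d (x a) (y b) i j)"
      using zero that by (intro sum.mono_neutral_right) auto
    finally show ?thesis by simp
  qed
  have Ey: "mprod d E (y a) i j = mprod d (x a) (y a) i j" if "i < d" "j < d" for i j
  proof -
    have "mprod d E (y a) i j = (\<Sum>b\<in>UNIV. mprod d (x b) (y a) i j)"
      unfolding E_def[abs_def] by (rule mprod_sum_left)
    also have "\<dots> = (\<Sum>b\<in>{a}. mprod d (x b) (y a) i j)"
      using zero that by (intro sum.mono_neutral_right) auto
    finally show ?thesis by simp
  qed
  have anti: "mprod d E D i j = - mprod d D E i j" if "i < d" "j < d" for i j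
  proof -
    have "mprod d E D i j = mprod d E (x a) i j - mprod d E (y a) i j"
      by (simp add: mprod_def D_def algebra_simps sum_subtractf)
    \<comment> \<open>Transposing x E = x y = E y, with all factors symmetric, gives E x = y x = y
      E.\<close>
    also have "mprod d E (x a) i j = mprod d (y a) E i j"
      using that by (simp add: mprod_transpose[OF psd_E x] mprod_transpose[OF y psd_E] xE Ey)
    also have "mprod d E (y a) i j = mprod d (x a) E i j"
      using that by (simp add: xE Ey)
    finally show ?thesis
      by (simp add: mprod_def D_def algebra_simps sum_subtractf)
  qed
  \<comment> \<open>\<open>T\<close> is Tr(D E D), written as the sum of the form of
    \<open>E\<close> over the columns of \<open>D\<close>. Moving \<open>E\<close> past
    \<open>D\<close> changes the sign and yields the same sum over the rows; as \<open>D\<close> is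
    symmetric, T = -T.\<close>
  define T where "T = (\<Sum>l<d. bilin d E (\<lambda>k. D k l) (\<lambda>k. D k l))"
  have "T = (\<Sum>l<d. \<Sum>k<d. D k l * mprod d E D k l)"
    by (simp add: T_def bilin_def mprod_def sum_distrib_left mult_ac)
  also have "\<dots> = (\<Sum>l<d. \<Sum>k<d. - (D k l * mprod d D E k l))"
    using anti by simp
  also have "\<dots> = - (\<Sum>k<d. \<Sum>l<d. D k l * mprod d D E k l)"
    by (subst sum.swap) (simp add: sum_negf)
  also have "(\<Sum>k<d. \<Sum>l<d. D k l * mprod d D E k l) = (\<Sum>k<d. bilin d E (D k) (D k))"
    unfolding bilin_def mprod_def sum_distrib_left
    by (intro sum.cong refl) (simp add: psd_fun_sym[OF psd_E] mult_ac)
  also have "\<dots> = T"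
    unfolding T_def by (intro sum.cong refl bilin_cong) (use D_sym in auto)
  finally have "T = 0" by simp
  then have D_E: "bilin d E (\<lambda>k. D k l) (\<lambda>k. D k l) = 0" if "l < d" for l
    using that unfolding T_def by (simp add: sum_nonneg_eq_0_iff psd_fun_nonneg[OF psd_E])
  have Dx: "(\<Sum>k<d. x a i k * D k l) = 0" if "i < d" "l < d" for i l
  proof -
    have "(\<Sum>b\<in>UNIV. bilin d (x b) (\<lambda>k. D k l) (\<lambda>k. D k l)) = 0"
      using D_E that by (simp add: E_def[abs_def] bilin_sum)
    then have "bilin d (x a) (\<lambda>k. D k l) (\<lambda>k. D k l) = 0"
      by (simp add: sum_nonneg_eq_0_iff psd_fun_nonneg[OF x])
    then show ?thesis using bilin_isotropic[OF x] that by blast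
  qed
  have Dy: "(\<Sum>k<d. y a i k * D k l) = 0" if "i < d" "l < d" for i l
  proof -
    \<comment> \<open>\<open>E\<close> is by definition the sum of the \<open>x b\<close>, but
      agrees with the sum of the \<open>y b\<close> only below \<open>d\<close>, so the replacement
      takes place inside the bounded sums.\<close>
    have "bilin d E (\<lambda>k. D k l) (\<lambda>k. D k l) =
        bilin d (\<lambda>i j. \<Sum>b\<in>UNIV. y b i j) (\<lambda>k. D k l) (\<lambda>k. D k l)"
      unfolding bilin_def by (intro sum.cong refl) (simp add: E_y)
    then have "(\<Sum>b\<in>UNIV. bilin d (y b) (\<lambda>k. D k l) (\<lambda>k. D k l)) = 0"
      using D_E that by (simp add: bilin_sum)
    then have "bilin d (y a) (\<lambda>k. D k l) (\<lambda>k. D k l) = 0"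
      by (simp add: sum_nonneg_eq_0_iff psd_fun_nonneg[OF y])
    then show ?thesis using bilin_isotropic[OF y] that by blast
  qed
  \<comment> \<open>The squared norm of column \<open>j\<close> is a diagonal entry of D D, that is,
    of x D - y D, where both terms vanish.\<close>
  have "(\<Sum>k<d. D k j * D k j) = (\<Sum>k<d. x a j k * D k j) - (\<Sum>k<d. y a j k * D k j)"
    unfolding sum_subtractf[symmetric] left_diff_distrib[symmetric] D_def[symmetric]
    using D_sym ij by (intro sum.cong refl) simp
  then have "(\<Sum>k<d. D k j * D k j) = 0" using Dx Dy ij by simp
  then have "D i j = 0" using ij by (simp add: sum_nonneg_eq_0_iff)
  then show ?thesis by (simp add: D_def)
qed

section \<open>The trace inner product\<close>

lemma frob_commute: "frob d A B = frob d B A"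
  by (simp add: frob_def mult.commute)

lemma frob_cong:
  assumes "\<And>i j. i < d \<Longrightarrow> j < d \<Longrightarrow> A i j = A' i j"
    and "\<And>i j. i < d \<Longrightarrow> j < d \<Longrightarrow> B i j = B' i j"
  shows "frob d A B = frob d A' B'"
  unfolding frob_def using assms by simp

lemma frob_sum_left: "frob d (\<lambda>i j. \<Sum>a\<in>I. M a i j) B = (\<Sum>a\<in>I. frob d (M a) B)"
proof -
  have "frob d (\<lambda>i j. \<Sum>a\<in>I. M a i j) B = (\<Sum>i<d. \<Sum>a\<in>I. \<Sum>j<d. M a i j * B i j)"
    unfolding frob_def sum_distrib_right by (intro sum.cong refl sum.swap)
  also have "\<dots> = (\<Sum>a\<in>I. frob d (M a) B)"
    unfolding frob_def by (rule sum.swap)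
  finally show ?thesis .
qed

lemma frob_sum_right: "frob d A (\<lambda>i j. \<Sum>b\<in>J. N b i j) = (\<Sum>b\<in>J. frob d A (N b))"
  unfolding frob_commute[of d A] by (rule frob_sum_left)

lemma frob_sum:
  "frob d (\<lambda>i j. \<Sum>a\<in>I. M a i j) (\<lambda>i j. \<Sum>b\<in>J. N b i j) = (\<Sum>a\<in>I. \<Sum>b\<in>J. frob d (M a) (N b))"
  unfolding frob_sum_left frob_sum_right ..

text \<open>The squared distance is 1 - 2 + 1 = 0.\<close>

lemma frob_unit_eq:
  assumes "frob d A A = 1" "frob d A B = 1" "frob d B B = 1" "i < d" "j < d"
  shows "A i j = B i j"
proof -
  have "(\<Sum>i<d. \<Sum>j<d. (A i j - B i j)\<^sup>2) = frob d A A - 2 * frob d A B + frob d B B"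
    unfolding frob_def
    by (simp add: power2_eq_square algebra_simps sum.distrib sum_subtractf sum_distrib_left)
  then have "(\<Sum>i<d. \<Sum>j<d. (A i j - B i j)\<^sup>2) = 0" using assms by simp
  then have "(\<Sum>j<d. (A i j - B i j)\<^sup>2) = 0"
    using assms by (simp add: sum_nonneg_eq_0_iff sum_nonneg)
  then show ?thesis using assms by (simp add: sum_nonneg_eq_0_iff)
qed

section \<open>A common Gram representation for both cones\<close>

text \<open>Nonnegative vectors are treated as nonnegative diagonal matrices, so that both cones consist of
  Gram matrices of positive semidefinite matrices.\<close>

definition cone_factor :: "cone_name \<Rightarrow> nat \<Rightarrow> (nat \<Rightarrow> nat \<Rightarrow> real) \<Rightarrow> bool" where
  "cone_factor K d A \<longleftrightarrow> psd_fun d A \<and> (K = CP \<longrightarrow> (\<forall>i<d. \<forall>j<d. i \<noteq> j \<longrightarrow> A i j = 0))"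

lemma cone_factor_psd: "cone_factor K d A \<Longrightarrow> psd_fun d A"
  by (simp add: cone_factor_def)

lemma cone_factor_sum:
  assumes "\<And>a. a \<in> I \<Longrightarrow> cone_factor K d (M a)"
  shows "cone_factor K d (\<lambda>i j. \<Sum>a\<in>I. M a i j)"
  using assms psd_fun_sum[of I d M] by (simp add: cone_factor_def)

lemma psd_mat_iff_psd_fun:
  assumes "M \<in> carrier_mat d d"
  shows "psd_mat d M \<longleftrightarrow> psd_fun d (\<lambda>i j. M $$ (i, j))"
proof -
  have sym: "transpose_mat M = M \<longleftrightarrow> (\<forall>i<d. \<forall>j<d. M $$ (i, j) = M $$ (j, i))"
    using assms by (auto simp: mat_eq_iff)
  have quad: "scalar_prod v (M *\<^sub>v v) = bilin d (\<lambda>i j. M $$ (i, j)) (vec_index v) (vec_index v)"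
    if "v \<in> carrier_vec d" for v
    using assms that unfolding bilin_def scalar_prod_def
    by (auto simp: scalar_prod_def sum_distrib_left mult_ac lessThan_atLeast0 intro!: sum.cong)
  have "(\<forall>v \<in> carrier_vec d. scalar_prod v (M *\<^sub>v v) \<ge> 0) \<longleftrightarrow>
      (\<forall>v. bilin d (\<lambda>i j. M $$ (i, j)) v v \<ge> 0)"
  proof (intro iffI allI ballI)
    fix v assume *: "\<forall>v \<in> carrier_vec d. scalar_prod v (M *\<^sub>v v) \<ge> 0"
    \<comment> \<open>An arbitrary function is truncated to a vector of length \<open>d\<close>; the
      form reads no further entries.\<close>
    have "bilin d (\<lambda>i j. M $$ (i, j)) v v =
        bilin d (\<lambda>i j. M $$ (i, j)) (vec_index (Matrix.vec d v)) (vec_index (Matrix.vec d v))"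
      by (rule bilin_cong) auto
    also have "\<dots> \<ge> 0" using * quad[of "Matrix.vec d v"] by (metis vec_carrier)
    finally show "bilin d (\<lambda>i j. M $$ (i, j)) v v \<ge> 0" .
  qed (simp add: quad)
  then show ?thesis using assms sym by (simp add: psd_mat_def psd_fun_def)
qed

text \<open>The trace pairs entry (i,j) of \<open>M\<close> with entry (j,i) of \<open>N\<close>;
  symmetry of \<open>N\<close> makes this the entrywise product.\<close>

lemma mat_trace_psd:
  assumes "psd_mat d M" "psd_mat d N"
  shows "mat_trace (M * N) = frob d (\<lambda>i j. M $$ (i, j)) (\<lambda>i j. N $$ (i, j))"
proof -
  have c: "M \<in> carrier_mat d d" "N \<in> carrier_mat d d" using assms by (auto simp: psd_mat_def)
  then have "psd_fun d (\<lambda>i j. N $$ (i, j))" using assms psd_mat_iff_psd_fun by blast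
  from psd_fun_sym[OF this] show ?thesis
    using c unfolding mat_trace_def frob_def
    by (auto simp: scalar_prod_def lessThan_atLeast0 intro!: sum.cong)
qed

lemma bilin_diag:
  assumes "\<And>i j. i < d \<Longrightarrow> j < d \<Longrightarrow> i \<noteq> j \<Longrightarrow> A i j = 0"
  shows "bilin d A v w = (\<Sum>i<d. v i * A i i * w i)"
  unfolding bilin_def
proof (intro sum.cong refl)
  fix i assume "i \<in> {..<d}"
  then have "(\<Sum>j<d. v i * A i j * w j) = (\<Sum>j\<in>{i}. v i * A i j * w j)"
    using assms by (intro sum.mono_neutral_right) auto
  then show "(\<Sum>j<d. v i * A i j * w j) = v i * A i i * w i" by simp
qed

lemma frob_diag:
  assumes "\<And>i j. i < d \<Longrightarrow> j < d \<Longrightarrow> i \<noteq> j \<Longrightarrow> A i j = 0"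
  shows "frob d A B = (\<Sum>i<d. A i i * B i i)"
  unfolding frob_def
proof (intro sum.cong refl)
  fix i assume "i \<in> {..<d}"
  then have "(\<Sum>j<d. A i j * B i j) = (\<Sum>j\<in>{i}. A i j * B i j)"
    using assms by (intro sum.mono_neutral_right) auto
  then show "(\<Sum>j<d. A i j * B i j) = A i i * B i i" by simp
qed

text \<open>This makes all later arguments uniform in \<open>K\<close>. For \<open>CP\<close>,
  vectors go to diagonal matrices and back: scalar products become trace products, and the diagonal
  of a semidefinite matrix is nonnegative.\<close>

lemma matrix_cone_iff:
  "X \<in> matrix_cone K \<longleftrightarrow>
    (\<exists>d\<ge>1. \<exists>M. (\<forall>i. cone_factor K d (M i)) \<and> (\<forall>i j. X $ i $ j = frob d (M i) (M j)))"
proof (cases K)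
  case CP
  show ?thesis
  proof
    assume "X \<in> matrix_cone K"
    then obtain d x where d: "d \<ge> 1" and x: "\<And>i. nonneg_vec d (x i)"
      and X: "\<And>i j. X $ i $ j = scalar_prod (x i) (x j)"
      using CP by (auto simp: completely_positive_def)
    define M where "M i k l = (if k = l then vec_index (x i) k else 0)" for i k l
    have "cone_factor K d (M i)" for i
    proof -
      have "bilin d (M i) v v \<ge> 0" for v
      proof -
        have "bilin d (M i) v v = (\<Sum>k<d. vec_index (x i) k * (v k)\<^sup>2)"
          by (subst bilin_diag) (auto simp: M_def power2_eq_square mult_ac)
        also have "\<dots> \<ge> 0" using x[of i] by (auto simp: nonneg_vec_def intro!: sum_nonneg)
        finally show ?thesis .
      qed
      then show ?thesis by (auto simp: cone_factor_def psd_fun_def M_def)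
    qed
    moreover have "X $ i $ j = frob d (M i) (M j)" for i j
      using x[of j] by (subst frob_diag)
        (auto simp: X M_def nonneg_vec_def scalar_prod_def lessThan_atLeast0)
    ultimately show "\<exists>d\<ge>1. \<exists>M. (\<forall>i. cone_factor K d (M i)) \<and> (\<forall>i j. X $ i $ j = frob d (M i) (M j))"
      using d by blast
  next
    assume "\<exists>d\<ge>1. \<exists>M. (\<forall>i. cone_factor K d (M i)) \<and> (\<forall>i j. X $ i $ j = frob d (M i) (M j))"
    then obtain d M where d: "d \<ge> 1" and M: "\<And>i. cone_factor K d (M i)"
      and X: "\<And>i j. X $ i $ j = frob d (M i) (M j)" by blast
    have nonneg: "M i k k \<ge> 0" if "k < d" for i k
      using psd_fun_nonneg[OF cone_factor_psd[OF M], of i "unitv k"] that by (simp add: bilin_unitv)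
    have "nonneg_vec d (Matrix.vec d (\<lambda>k. M i k k))" for i
      using nonneg by (simp add: nonneg_vec_def)
    moreover have "X $ i $ j =
        scalar_prod (Matrix.vec d (\<lambda>k. M i k k)) (Matrix.vec d (\<lambda>k. M j k k))" for i j
      unfolding X using M[of i] CP
      by (subst frob_diag) (auto simp: cone_factor_def scalar_prod_def lessThan_atLeast0)
    ultimately have "X \<in> completely_positive"
      unfolding completely_positive_def using d
      by (intro CollectI exI[of _ d] conjI exI[of _ "\<lambda>i. Matrix.vec d (\<lambda>k. M i k k)"]) auto
    then show "X \<in> matrix_cone K" using CP by simp
  qed
next
  case CSplus
  show ?thesis
  proof
    assume "X \<in> matrix_cone K"
    then obtain d M where d: "d \<ge> 1" and M: "\<And>i. psd_mat d (M i)"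
      and X: "\<And>i j. X $ i $ j = mat_trace (M i * M j)"
      using CSplus by (auto simp: completely_psd_def)
    have "cone_factor K d (\<lambda>k l. M i $$ (k, l))" for i
      using M[of i] psd_mat_iff_psd_fun[of "M i" d] CSplus by (auto simp: psd_mat_def cone_factor_def)
    then show "\<exists>d\<ge>1. \<exists>M. (\<forall>i. cone_factor K d (M i)) \<and> (\<forall>i j. X $ i $ j = frob d (M i) (M j))"
      using d X mat_trace_psd[OF M M]
      by (intro exI[of _ d] conjI exI[of _ "\<lambda>i k l. M i $$ (k, l)"]) auto
  next
    assume "\<exists>d\<ge>1. \<exists>M. (\<forall>i. cone_factor K d (M i)) \<and> (\<forall>i j. X $ i $ j = frob d (M i) (M j))"
    then obtain d M where d: "d \<ge> 1" and M: "\<And>i. cone_factor K d (M i)"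
      and X: "\<And>i j. X $ i $ j = frob d (M i) (M j)" by blast
    define N where "N i = Matrix.mat d d (\<lambda>(k, l). M i k l)" for i
    have entry: "N i $$ (k, l) = M i k l" if "k < d" "l < d" for i k l
      using that by (simp add: N_def)
    have "psd_fun d (\<lambda>k l. N i $$ (k, l)) \<longleftrightarrow> psd_fun d (M i)" for i
      unfolding psd_fun_def bilin_def by (simp add: entry)
    then have N: "psd_mat d (N i)" for i
      using psd_mat_iff_psd_fun[of "N i" d] cone_factor_psd[OF M] by (simp add: N_def)
    have "X $ i $ j = mat_trace (N i * N j)" for i j
      unfolding X mat_trace_psd[OF N N] by (rule frob_cong) (simp_all add: entry)
    then have "X \<in> completely_psd"
      unfolding completely_psd_def using d N by blast
    then show "X \<in> matrix_cone K" using CSplus by simp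
  qed
qed

lemma matrix_cone_nonneg:
  assumes "X \<in> matrix_cone K"
  shows "X $ i $ j \<ge> 0"
  using assms unfolding matrix_cone_iff by (metis cone_factor_psd frob_psd_nonneg)

text \<open>The map \<open>f\<close> need not be injective: besides passing to principal
  submatrices, this allows repeating Gram factors, as when one copy of the questions is
  doubled.\<close>

lemma matrix_cone_reindex:
  assumes "X \<in> matrix_cone K"
  shows "(\<chi> i j. X $ f i $ f j) \<in> matrix_cone K"
proof -
  obtain d M where "d \<ge> 1" "\<And>i. cone_factor K d (M i)" "\<And>i j. X $ i $ j = frob d (M i) (M j)"
    using assms unfolding matrix_cone_iff by blast
  then show ?thesis
    unfolding matrix_cone_iff by (intro exI[of _ d] conjI exI[of _ "\<lambda>i. M (f i)"]) auto
qed

text \<open>By bilinearity, conditions on block sums become conditions on norms and inner products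
  of the summed factors.\<close>

lemma block_sum_frob:
  assumes "\<And>i j. X $ i $ j = frob d (M i) (M j)"
  shows "block_sum I J X = frob d (\<lambda>k l. \<Sum>i\<in>I. M i k l) (\<lambda>k l. \<Sum>j\<in>J. M j k l)"
  unfolding block_sum_def frob_sum assms ..

lemma sum_image_UNIV: "inj f \<Longrightarrow> (\<Sum>i\<in>range f. g i) = (\<Sum>i\<in>UNIV. g (f i))"
  by (simp add: sum.reindex)

lemma block_sum_sum_block:
  "block_sum (sum_block (Inl s)) (sum_block (Inl s')) X = (\<Sum>a\<in>UNIV. \<Sum>b\<in>UNIV. X $ Inl (s, a) $ Inl (s', b))"
  "block_sum (sum_block (Inl s)) (sum_block (Inr t')) X = (\<Sum>a\<in>UNIV. \<Sum>b\<in>UNIV. X $ Inl (s, a) $ Inr (t', b))"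
  "block_sum (sum_block (Inr t)) (sum_block (Inl s')) X = (\<Sum>a\<in>UNIV. \<Sum>b\<in>UNIV. X $ Inr (t, a) $ Inl (s', b))"
  "block_sum (sum_block (Inr t)) (sum_block (Inr t')) X = (\<Sum>a\<in>UNIV. \<Sum>b\<in>UNIV. X $ Inr (t, a) $ Inr (t', b))"
  by (simp_all add: block_sum_def sum_image_UNIV inj_def)

lemma block_sum_block:
  "block_sum (block s) (block s') X = (\<Sum>a\<in>UNIV. \<Sum>b\<in>UNIV. X $ (s, a) $ (s', b))"
  by (simp add: block_sum_def block_def sum_image_UNIV inj_def)

section \<open>Winning probabilities and perfect strategies\<close>

lemma Corr_nonneg: "p \<in> Corr K \<Longrightarrow> p a b s t \<ge> 0"
  unfolding Corr_def mem_Collect_eq using matrix_cone_nonneg by metis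

lemma Corr_sum: "p \<in> Corr K \<Longrightarrow> (\<Sum>a\<in>UNIV. \<Sum>b\<in>UNIV. p a b s t) = 1"
proof -
  assume "p \<in> Corr K"
  then obtain X where "\<forall>i j. block_sum (sum_block i) (sum_block j) X = 1"
    and "\<forall>s a t b. X $ Inl (s, a) $ Inr (t, b) = p a b s t"
    unfolding Corr_def by blast
  then show ?thesis using block_sum_sum_block(2)[of s t X] by (simp del: sum_block.simps)
qed

text \<open>The complement is the probability of losing, a sum of nonnegative terms. Both the bound
  1 and its equality case can be read off from it.\<close>

lemma one_minus_winning_prob:
  assumes "p \<in> Corr K"
  shows "1 - winning_prob \<pi> V p =
    (\<Sum>s\<in>UNIV. \<Sum>t\<in>UNIV. pmf \<pi> (s, t) * (\<Sum>a\<in>UNIV. \<Sum>b\<in>UNIV. of_bool (\<not> V a b s t) * p a b s t))"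
proof -
  have "(\<Sum>s\<in>UNIV. \<Sum>t\<in>UNIV. pmf \<pi> (s, t)) = 1"
    using sum_pmf_eq_1[of UNIV \<pi>] by (simp add: sum.cartesian_product)
  then have "1 = (\<Sum>s\<in>UNIV. \<Sum>t\<in>UNIV. pmf \<pi> (s, t) * (\<Sum>a\<in>UNIV. \<Sum>b\<in>UNIV. p a b s t))"
    by (simp add: Corr_sum[OF assms])
  also have "\<dots> - winning_prob \<pi> V p = (\<Sum>s\<in>UNIV. \<Sum>t\<in>UNIV. pmf \<pi> (s, t) *
      (\<Sum>a\<in>UNIV. \<Sum>b\<in>UNIV. p a b s t - of_bool (V a b s t) * p a b s t))"
    unfolding winning_prob_def by (simp add: sum_subtractf right_diff_distrib)
  also have "\<dots> = (\<Sum>s\<in>UNIV. \<Sum>t\<in>UNIV. pmf \<pi> (s, t) *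
      (\<Sum>a\<in>UNIV. \<Sum>b\<in>UNIV. of_bool (\<not> V a b s t) * p a b s t))"
    by (simp add: algebra_simps of_bool_not_iff)
  finally show ?thesis .
qed

lemma winning_prob_le_1:
  assumes "p \<in> Corr K"
  shows "winning_prob \<pi> V p \<le> 1"
proof -
  have "1 - winning_prob \<pi> V p \<ge> 0"
    unfolding one_minus_winning_prob[OF assms]
    by (intro sum_nonneg mult_nonneg_nonneg Corr_nonneg[OF assms]) auto
  then show ?thesis by simp
qed

lemma winning_prob_eq_1_iff:
  assumes "p \<in> Corr K"
  shows "winning_prob \<pi> V p = 1 \<longleftrightarrow>
    (\<forall>a b s t. pmf \<pi> (s, t) > 0 \<and> \<not> V a b s t \<longrightarrow> p a b s t = 0)"
proof -
  have "winning_prob \<pi> V p = 1 \<longleftrightarrow> 1 - winning_prob \<pi> V p = 0" by auto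
  also have "\<dots> \<longleftrightarrow> (\<forall>s t. pmf \<pi> (s, t) = 0 \<or> (\<forall>a b. V a b s t \<or> p a b s t = 0))"
    unfolding one_minus_winning_prob[OF assms]
    by (simp add: sum_nonneg_eq_0_iff sum_nonneg Corr_nonneg[OF assms]) blast
  also have "\<dots> \<longleftrightarrow> (\<forall>a b s t. pmf \<pi> (s, t) > 0 \<and> \<not> V a b s t \<longrightarrow> p a b s t = 0)"
    by (metis less_irrefl pmf_pos)
  finally show ?thesis .
qed

text \<open>As 1 bounds every winning probability, attaining it already settles the supremum. What
  remains is that \<open>p\<close> vanishes on losing answers to questions of positive
  weight.\<close>

lemma perfect_strategy_iff:
  "perfect_strategy K \<pi> V \<longleftrightarrow>
    (\<exists>p \<in> Corr K. \<forall>a b s t. pmf \<pi> (s, t) > 0 \<and> \<not> V a b s t \<longrightarrow> p a b s t = 0)"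
proof -
  have "(SUP p \<in> Corr K. ereal (winning_prob \<pi> V p)) = 1"
    if "p \<in> Corr K" "winning_prob \<pi> V p = 1" for p
  proof (rule antisym)
    show "(SUP p \<in> Corr K. ereal (winning_prob \<pi> V p)) \<le> 1"
      by (rule SUP_least) (simp add: winning_prob_le_1)
    show "1 \<le> (SUP p \<in> Corr K. ereal (winning_prob \<pi> V p))"
      using that by (intro SUP_upper2[of p]) auto
  qed
  then show ?thesis
    unfolding perfect_strategy_def using winning_prob_eq_1_iff by blast
qed

section \<open>The cycle of implications\<close>

text \<open>The witness is Alice's principal block. Once the factors of both players agree, it
  equals the block between Alice and Bob, which carries \<open>p\<close> and its zeros.\<close>

lemma perfect_strategy_imp_reduced:
  fixes \<pi> :: "('s::finite \<times> 's) pmf" and V :: "('a::finite, 'a, 's, 's) predicate"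
  assumes sync: "synchronous_game \<pi> V" and perfect: "perfect_strategy K \<pi> V"
  shows "\<exists>X :: real^('s \<times> 'a)^('s \<times> 'a). X \<in> matrix_cone K \<and>
        (\<forall>s s'. block_sum (block s) (block s') X = 1) \<and>
        (\<forall>s a a'. a \<noteq> a' \<longrightarrow> X $ (s, a) $ (s, a') = 0) \<and>
        (\<forall>a a' s s'. pmf \<pi> (s, s') > 0 \<and> \<not> V a a' s s' \<longrightarrow> X $ (s, a) $ (s', a') = 0)"
proof -
  obtain p where "p \<in> Corr K"
    and p0: "\<And>a b s t. pmf \<pi> (s, t) > 0 \<Longrightarrow> \<not> V a b s t \<Longrightarrow> p a b s t = 0"
    using perfect unfolding perfect_strategy_iff by blast
  then obtain X :: "real^(('s \<times> 'a) + ('s \<times> 'a))^(('s \<times> 'a) + ('s \<times> 'a))"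
    where X: "X \<in> matrix_cone K"
      and blocks: "\<And>i j. block_sum (sum_block i) (sum_block j) X = 1"
      and Xp: "\<And>s a t b. X $ Inl (s, a) $ Inr (t, b) = p a b s t"
    unfolding Corr_def by blast
  obtain d M where M: "\<And>i. cone_factor K d (M i)" and XM: "\<And>i j. X $ i $ j = frob d (M i) (M j)"
    using X unfolding matrix_cone_iff by blast
  have sums: "(\<Sum>a\<in>UNIV. M (Inl (s, a)) k l) = (\<Sum>a\<in>UNIV. M (Inr (s, a)) k l)"
    if "k < d" "l < d" for s k l
  proof -
    have "(\<Sum>i\<in>sum_block (Inl s). M i k l) = (\<Sum>i\<in>sum_block (Inr s). M i k l)"
      by (rule frob_unit_eq[of d "\<lambda>k l. \<Sum>i\<in>sum_block (Inl s). M i k l"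
            "\<lambda>k l. \<Sum>i\<in>sum_block (Inr s). M i k l"])
        (use blocks that in \<open>simp_all only: block_sum_frob[OF XM]\<close>)
    then show ?thesis by (simp add: sum_image_UNIV inj_def)
  qed
  have orth: "frob d (M (Inl (s, a))) (M (Inr (s, b))) = 0" if "a \<noteq> b" for s a b
    using sync p0[of s s a b] that by (simp add: synchronous_game_def Xp flip: XM)
  have eq: "M (Inl (s, a)) k l = M (Inr (s, a)) k l" if "k < d" "l < d" for s a k l
    by (rule orthogonal_decompositions_eq[of d "\<lambda>a. M (Inl (s, a))" "\<lambda>a. M (Inr (s, a))"])
      (use M cone_factor_psd sums orth that in auto)
  define Y :: "real^('s \<times> 'a)^('s \<times> 'a)" where "Y = (\<chi> i j. X $ Inl i $ Inl j)"
  have Yp: "Y $ (s, a) $ (t, b) = p a b s t" for s a t b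
  proof -
    have "frob d (M (Inl (s, a))) (M (Inl (t, b))) = frob d (M (Inl (s, a))) (M (Inr (t, b)))"
      using eq by (intro frob_cong) auto
    then show ?thesis by (simp add: Y_def XM flip: Xp)
  qed
  have "Y \<in> matrix_cone K" unfolding Y_def by (rule matrix_cone_reindex[OF X])
  moreover have "block_sum (block s) (block s') Y = 1" for s s'
    using blocks[of "Inl s" "Inl s'"] by (simp add: Y_def block_sum_block block_sum_sum_block del: sum_block.simps)
  moreover have "Y $ (s, a) $ (s, a') = 0" if "a \<noteq> a'" for s a a'
    using sync that by (simp add: Yp p0 synchronous_game_def)
  ultimately show ?thesis using p0 by (intro exI[of _ Y]) (auto simp: Yp)
qed

lemma reduced_imp_extended:
  fixes X :: "real^('s::finite \<times> 'a::finite)^('s \<times> 'a)"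
  assumes X: "X \<in> matrix_cone K" and blocks: "\<And>s s'. block_sum (block s) (block s') X = 1"
  obtains Y :: "real^(('s \<times> 'a) option)^(('s \<times> 'a) option)" where
    "Y \<in> matrix_cone K"
    "\<And>s. block_sum (block0 s) (block0 s) Y = 1" "\<And>s. block_sum (block0 None) (block0 s) Y = 1"
    "\<And>i j. Y $ Some i $ Some j = X $ i $ j"
proof -
  obtain d M where d: "d \<ge> 1" and M: "\<And>i. cone_factor K d (M i)"
    and XM: "\<And>i j. X $ i $ j = frob d (M i) (M j)"
    using X unfolding matrix_cone_iff by blast
  define E where "E s k l = (\<Sum>i\<in>block s. M i k l)" for s k l
  \<comment> \<open>The index 0 receives the block sum of an arbitrary question, named
    \<open>undefined\<close>. Below, \<open>t\<close> treats 0 as that question, so every block sum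
    of \<open>Y\<close> is one of \<open>X\<close>.\<close>
  define N where "N = case_option (E undefined) M"
  define Y :: "real^(('s \<times> 'a) option)^(('s \<times> 'a) option)" where "Y = (\<chi> i j. frob d (N i) (N j))"
  have "cone_factor K d (N i)" for i
    using M cone_factor_sum[of "block undefined" K d M]
    by (cases i) (auto simp: N_def E_def[abs_def])
  then have 1: "Y \<in> matrix_cone K"
    unfolding matrix_cone_iff using d by (intro exI[of _ d] conjI exI[of _ N]) (auto simp: Y_def)
  define t where "t i = (case i of None \<Rightarrow> undefined | Some s \<Rightarrow> s)" for i :: "'s option"
  have N_sum: "(\<lambda>k l. \<Sum>j\<in>block0 i. N j k l) = E (t i)" for i
    by (cases i) (auto simp: N_def E_def[abs_def] t_def block_def sum_image_UNIV inj_def)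
  have "block_sum (block0 i) (block0 j) Y = 1" for i j
  proof -
    have "block_sum (block0 i) (block0 j) Y = frob d (E (t i)) (E (t j))"
      using block_sum_frob[of Y d N "block0 i" "block0 j"] by (simp add: Y_def N_sum)
    also have "\<dots> = block_sum (block (t i)) (block (t j)) X"
      using block_sum_frob[OF XM] by (simp add: E_def[abs_def])
    finally show ?thesis using blocks by simp
  qed
  moreover have "Y $ Some i $ Some j = X $ i $ j" for i j by (simp add: Y_def N_def XM)
  ultimately show ?thesis using that 1 by blast
qed

text \<open>Block sums between different questions are not prescribed here. They follow because each
  summed block has norm 1 and inner product 1 with the unit factor at index 0, hence equals
  it.\<close>

lemma extended_imp_perfect_strategy:
  fixes X :: "real^(('s::finite \<times> 'a::finite) option)^(('s \<times> 'a) option)"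
  assumes X: "X \<in> matrix_cone K"
    and blocks: "\<And>s. block_sum (block0 s) (block0 s) X = 1" "\<And>s. block_sum (block0 None) (block0 s) X = 1"
    and lose: "\<And>a a' s s'. pmf \<pi> (s, s') > 0 \<Longrightarrow> \<not> V a a' s s' \<Longrightarrow> X $ Some (s, a) $ Some (s', a') = 0"
  shows "perfect_strategy K \<pi> V"
proof -
  obtain d M where M: "\<And>i. cone_factor K d (M i)"
    and XM: "\<And>i j. X $ i $ j = frob d (M i) (M j)"
    using X unfolding matrix_cone_iff by blast
  have eq: "(\<Sum>i\<in>block0 None. M i k l) = (\<Sum>i\<in>block0 s. M i k l)" if "k < d" "l < d" for s k l
    by (rule frob_unit_eq[of d "\<lambda>k l. \<Sum>i\<in>block0 None. M i k l" "\<lambda>k l. \<Sum>i\<in>block0 s. M i k l"])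
      (use blocks that in \<open>simp_all only: block_sum_frob[OF XM]\<close>)
  have all: "block_sum (block0 s) (block0 s') X = 1" for s s'
  proof -
    have "block_sum (block0 s) (block0 s') X = block_sum (block0 None) (block0 s') X"
      unfolding block_sum_frob[OF XM] by (rule frob_cong) (use eq in auto)
    then show ?thesis using blocks by simp
  qed
  have sum1: "(\<Sum>a\<in>UNIV. \<Sum>b\<in>UNIV. X $ Some (s, a) $ Some (s', b)) = 1" for s s'
    using all[of "Some s" "Some s'"] by (simp add: block_sum_def sum_image_UNIV inj_def)
  \<comment> \<open>Both copies of a pair go to the same index and 0 is dropped, so the block
    between the players is again that of \<open>X\<close>, with its zeros.\<close>
  define f :: "('s \<times> 'a) + ('s \<times> 'a) \<Rightarrow> ('s \<times> 'a) option" where "f = case_sum Some Some"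
  define Y :: "real^(('s \<times> 'a) + ('s \<times> 'a))^(('s \<times> 'a) + ('s \<times> 'a))"
    where "Y = (\<chi> i j. X $ f i $ f j)"
  define p where "p a b s t = X $ Some (s, a) $ Some (t, b)" for a b s t
  have "Y \<in> matrix_cone K" unfolding Y_def by (rule matrix_cone_reindex[OF X])
  moreover have "block_sum (sum_block i) (sum_block j) Y = 1" for i j
    by (cases i; cases j) (simp_all only: block_sum_sum_block, simp_all add: Y_def f_def sum1)
  moreover have "Y $ Inl (s, a) $ Inr (t, b) = p a b s t" for s a t b
    by (simp add: Y_def f_def p_def)
  ultimately have "p \<in> Corr K" unfolding Corr_def by blast
  then show ?thesis unfolding perfect_strategy_iff using lose by (intro bexI[of _ p]) (simp_all add: p_def)
qed

theorem theorem5p10: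
  fixes \<pi> :: "('s::finite \<times> 's) pmf"
    and V :: "('a::finite, 'a, 's, 's) predicate"
    and K :: cone_name
  assumes "synchronous_game \<pi> V"
  shows "(perfect_strategy K \<pi> V \<longleftrightarrow>
      (\<exists>X :: real^('s \<times> 'a)^('s \<times> 'a). X \<in> matrix_cone K \<and>
        (\<forall>s s'. block_sum (block s) (block s') X = 1) \<and>
        (\<forall>s a a'. a \<noteq> a' \<longrightarrow> X $ (s, a) $ (s, a') = 0) \<and>
        (\<forall>a a' s s'. pmf \<pi> (s, s') > 0 \<and> \<not> V a a' s s' \<longrightarrow> X $ (s, a) $ (s', a') = 0))) \<and>
    (perfect_strategy K \<pi> V \<longleftrightarrow>
      (\<exists>X :: real^(('s \<times> 'a) option)^(('s \<times> 'a) option). X \<in> matrix_cone K \<and>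
        (\<forall>s. block_sum (block0 s) (block0 s) X = 1 \<and> block_sum (block0 None) (block0 s) X = 1) \<and>
        (\<forall>s a a'. a \<noteq> a' \<longrightarrow> X $ Some (s, a) $ Some (s, a') = 0) \<and>
        (\<forall>a a' s s'. pmf \<pi> (s, s') > 0 \<and> \<not> V a a' s s' \<longrightarrow>
           X $ Some (s, a) $ Some (s', a') = 0)))"
proof -
  let ?X = "\<lambda>X :: real^('s \<times> 'a)^('s \<times> 'a). X \<in> matrix_cone K \<and>
        (\<forall>s s'. block_sum (block s) (block s') X = 1) \<and>
        (\<forall>s a a'. a \<noteq> a' \<longrightarrow> X $ (s, a) $ (s, a') = 0) \<and>
        (\<forall>a a' s s'. pmf \<pi> (s, s') > 0 \<and> \<not> V a a' s s' \<longrightarrow> X $ (s, a) $ (s', a') = 0)"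
  let ?Y = "\<lambda>X :: real^(('s \<times> 'a) option)^(('s \<times> 'a) option). X \<in> matrix_cone K \<and>
        (\<forall>s. block_sum (block0 s) (block0 s) X = 1 \<and> block_sum (block0 None) (block0 s) X = 1) \<and>
        (\<forall>s a a'. a \<noteq> a' \<longrightarrow> X $ Some (s, a) $ Some (s, a') = 0) \<and>
        (\<forall>a a' s s'. pmf \<pi> (s, s') > 0 \<and> \<not> V a a' s s' \<longrightarrow>
           X $ Some (s, a) $ Some (s', a') = 0)"
  have 1: "\<exists>X. ?X X" if "perfect_strategy K \<pi> V"
    by (rule perfect_strategy_imp_reduced[OF assms that])
  have 2: "\<exists>Y. ?Y Y" if "\<exists>X. ?X X"
  proof -
    from that obtain X where X: "?X X" by blast
    obtain Y :: "real^(('s \<times> 'a) option)^(('s \<times> 'a) option)" where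
      "Y \<in> matrix_cone K"
      "\<And>s. block_sum (block0 s) (block0 s) Y = 1" "\<And>s. block_sum (block0 None) (block0 s) Y = 1"
      "\<And>i j. Y $ Some i $ Some j = X $ i $ j"
      by (rule reduced_imp_extended[of X K]) (use X in auto)
    with X have "?Y Y" by simp
    then show ?thesis by blast
  qed
  have 3: "perfect_strategy K \<pi> V" if "\<exists>Y. ?Y Y"
  proof -
    from that obtain Y where Y: "?Y Y" by blast
    show ?thesis by (rule extended_imp_perfect_strategy[of Y]) (use Y in auto)
  qed
  show ?thesis using 1 2 3 by blast
qed

end
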